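(* An ultrametric space $\mathbf{M}=(M,d)$ is homogeneous if and only if its group of surjective isometries $\mathrm{Iso}(\mathbf{M})$ acts transitively on $M$.
   Context: A metric space $\mathbf{M}=(M,d)$ is ultrametric if $d(x,z)\le\max\{d(x,y),d(y,z)\}$ for all $x,y,z\in M$. $\mathrm{Iso}(\mathbf{M})$ denotes the group of all distance-preserving maps of $M$ onto $M$. A metric space $\mathbf{M}$ is homogeneous if every isometry (distance-preserving bijection) $f$ from a finite subset of $M$ onto a finite subset of $M$ extends to a surjective isometry of $\mathbf{M}$ onto $\mathbf{M}$. *)

theory Defs
  imports "HOL-Analysis.Analysis" "HOL-Algebra.Group_Action"
begin

locale Ultrametric_space = Metric_space +
  assumes ultrametric: "\<lbrakk>x \<in> M; y \<in> M; z \<in> M\<rbrakk> \<Longrightarrow> d x z \<le> max (d x y) (d y z)"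

definition isometry :: "('a \<Rightarrow> 'a \<Rightarrow> real) \<Rightarrow> 'a set \<Rightarrow> 'a set \<Rightarrow> ('a \<Rightarrow> 'a) \<Rightarrow> bool"
  where "isometry d A B f \<longleftrightarrow>
    bij_betw f A B \<and> (\<forall>x\<in>A. \<forall>y\<in>A. d (f x) (f y) = d x y)"

text \<open>As in \<^const>\<open>BijGroup\<close>, the self-isometries of \<open>M\<close> are represented by functions that are
  extensional on \<open>M\<close>, so that each of them has exactly one representative.\<close>

definition Isometry_group :: "'a set \<Rightarrow> ('a \<Rightarrow> 'a \<Rightarrow> real) \<Rightarrow> ('a \<Rightarrow> 'a) monoid"
  where "Isometry_group M d =
    (BijGroup M)\<lparr>carrier := {f \<in> extensional M. isometry d M M f}\<rparr>"

definition homogeneous :: "'a set \<Rightarrow> ('a \<Rightarrow> 'a \<Rightarrow> real) \<Rightarrow> bool"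
  where "homogeneous M d \<longleftrightarrow>
    (\<forall>A B f. A \<subseteq> M \<longrightarrow> B \<subseteq> M \<longrightarrow> finite A \<longrightarrow> finite B \<longrightarrow> isometry d A B f \<longrightarrow>
      (\<exists>g\<in>carrier (Isometry_group M d). \<forall>x\<in>A. g x = f x))"

lemma (in Metric_space) carrier_Isometry_group:
  "carrier (Isometry_group M d) =
    {f \<in> extensional M. f ` M = M \<and> (\<forall>x\<in>M. \<forall>y\<in>M. d (f x) (f y) = d x y)}"
proof -
  have "inj_on f M" if "f ` M = M" "\<forall>x\<in>M. \<forall>y\<in>M. d (f x) (f y) = d x y" for f
  proof (rule inj_onI)
    fix x y assume "x \<in> M" "y \<in> M" "f x = f y"
    then show "x = y" using that by (metis imageI zero)
  qed
  then show ?thesis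
    by (auto simp: Isometry_group_def isometry_def bij_betw_def)
qed

lemma subgroup_Isometry_group:
  "subgroup (carrier (Isometry_group M d)) (BijGroup M)"
proof (rule group.subgroupI[OF group_BijGroup])
  let ?I = "carrier (Isometry_group M d)"
  have I: "?I = {f \<in> Bij M. \<forall>x\<in>M. \<forall>y\<in>M. d (f x) (f y) = d x y}"
    by (auto simp: Isometry_group_def isometry_def Bij_def)
  show "?I \<subseteq> carrier (BijGroup M)"
    by (auto simp: I BijGroup_def)
  have "(\<lambda>x\<in>M. x) \<in> ?I"
    by (auto simp: I id_Bij)
  then show "?I \<noteq> {}"
    by blast
  show "inv\<^bsub>BijGroup M\<^esub> f \<in> ?I" if "f \<in> ?I" for f
  proof -
    from that have f: "f \<in> Bij M" and d: "\<forall>x\<in>M. \<forall>y\<in>M. d (f x) (f y) = d x y"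
      by (auto simp: I)
    have "d (inv_into M f x) (inv_into M f y) = d x y" if "x \<in> M" "y \<in> M" for x y
    proof -
      have "f (inv_into M f x) = x" "f (inv_into M f y) = y"
        using f that by (auto simp: Bij_def bij_betw_def f_inv_into_f)
      then show ?thesis
        using d Bij_inv_into_mem[OF f] that by metis
    qed
    then show ?thesis
      using f by (auto simp: I inv_BijGroup restrict_inv_into_Bij)
  qed
  show "f \<otimes>\<^bsub>BijGroup M\<^esub> g \<in> ?I" if "f \<in> ?I" "g \<in> ?I" for f g
  proof -
    have "g x \<in> M" if "x \<in> M" for x
      using \<open>g \<in> ?I\<close> that Bij_imp_funcset by (auto simp: I)
    then show ?thesis
      using that by (auto simp: I BijGroup_def compose_Bij compose_eq)
  qed
qed

lemma group_action_Isometry_group: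
  "group_action (Isometry_group M d) M (\<lambda>g. g)"
proof -
  have eq: "Isometry_group M d = (BijGroup M)\<lparr>carrier := carrier (Isometry_group M d)\<rparr>"
    by (simp add: Isometry_group_def)
  have "group (Isometry_group M d)"
    using subgroup.subgroup_is_group[OF subgroup_Isometry_group group_BijGroup] eq by metis
  moreover have "(\<lambda>g. g) \<in> hom (Isometry_group M d) (BijGroup M)"
    using subgroup.subset[OF subgroup_Isometry_group[of M d]]
    by (auto simp: hom_def Isometry_group_def)
  ultimately show ?thesis
    by (simp add: group_action_def group_hom_def group_hom_axioms_def group_BijGroup)
qed

end

theory Submission
  imports Defs
begin

text \<open>Extend a partial isometry \<open>f\<close> one point \<open>a\<close> at a time: if \<open>g\<close> already extends the
  rest of \<open>f\<close> and \<open>s = d (g a) (f a)\<close>, then all other values of \<open>f\<close> are at distance at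
  least \<open>s\<close> from both \<open>g a\<close> and \<open>f a\<close>. An isometry taking \<open>g a\<close> to \<open>f a\<close>, used to
  interchange the open balls of radius \<open>s\<close> around these points and replaced by the identity
  elsewhere, is again an isometry and corrects \<open>g\<close> at \<open>a\<close>.\<close>

text \<open>An involution is its own preimage map, so \<open>h\<close> is onto \<open>M\<close>;
  \<open>restrict\<close> supplies the extensionality.\<close>

lemma (in Metric_space) involution_in_Isometry_group:
  assumes "\<And>x. x \<in> M \<Longrightarrow> h x \<in> M" "\<And>x. x \<in> M \<Longrightarrow> h (h x) = x"
    "\<And>x y. \<lbrakk>x \<in> M; y \<in> M\<rbrakk> \<Longrightarrow> d (h x) (h y) = d x y"
  shows "restrict h M \<in> carrier (Isometry_group M d)"
proof -
  have "h ` M = M"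
    using assms(1,2) by (auto simp: image_iff) metis
  then show ?thesis
    using assms(3) by (simp add: carrier_Isometry_group)
qed

context Ultrametric_space
begin

text \<open>In the bound of \<open>d y z\<close> by \<open>max (d y x) (d x z)\<close> the strict
  inequality rules out the first term; the reverse bound is the ultrametric inequality
  itself.\<close>

lemma isosceles:
  assumes "x \<in> M" "y \<in> M" "z \<in> M" "d x y < d y z"
  shows "d x z = d y z"
  using ultrametric[of x y z] ultrametric[of y x z] assms commute[of x y] by auto

lemma ball_swap:
  assumes a: "a \<in> M" and b: "b \<in> M"
    and g: "g \<in> carrier (Isometry_group M d)" and gab: "g a = b"
  obtains h where "h \<in> carrier (Isometry_group M d)" "h a = b"
    "\<And>x. \<lbrakk>x \<in> M; d a b \<le> d a x; d a b \<le> d b x\<rbrakk> \<Longrightarrow> h x = x"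
proof (cases "a = b")
  case True
  have "restrict (\<lambda>x. x) M \<in> carrier (Isometry_group M d)"
    by (rule involution_in_Isometry_group) auto
  then show ?thesis
    using that[of "restrict (\<lambda>x. x) M"] True a by simp
next
  case False
  define s where "s = d a b"
  have s: "s > 0" "d a b = s" "d b a = s"
    using False a b mdist_pos_eq[of a b] by (auto simp: s_def commute)
  from g have gM: "g ` M = M" and gd: "\<And>x y. \<lbrakk>x \<in> M; y \<in> M\<rbrakk> \<Longrightarrow> d (g x) (g y) = d x y"
    by (auto simp: carrier_Isometry_group)
  have inj: "inj_on g M"
    using gd gM by (metis imageI inj_onI zero)
  define k where "k = inv_into M g"
  have gk: "g (k x) = x" "k x \<in> M" and kg: "k (g x) = x" and gin: "g x \<in> M" if "x \<in> M" for x
    using that gM inj by (auto simp: k_def f_inv_into_f inv_into_into)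
  have kd: "d (k x) (k y) = d x y" if "x \<in> M" "y \<in> M" for x y
    using gd[of "k x" "k y"] gk that by simp
  have kba: "k b = a"
    using kg[OF a] gab by simp
  \<comment> \<open>The way back from \<open>b\<close> uses the inverse \<open>k\<close>, since
    \<open>g b\<close> may be any point; this makes \<open>h\<close> an involution.\<close>
  define h where "h x = (if d a x < s then g x else if d b x < s then k x else x)" for x
  have g_ball: "d b (g x) < s" if "x \<in> M" "d a x < s" for x
    using gd[OF a, of x] that gab by simp
  have k_ball: "d a (k x) < s" if "x \<in> M" "d b x < s" for x
    using kd[OF b, of x] that kba by simp
  \<comment> \<open>The two open balls are disjoint: each point of one has distance exactly
    \<open>s\<close> from the centre of the other.\<close>
  have far: "d b x = s" if "x \<in> M" "d a x < s" for x
    using isosceles[of x a b] a b that s by (simp add: commute)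
  have far': "d a x = s" if "x \<in> M" "d b x < s" for x
    using isosceles[of x b a] a b that s by (simp add: commute)
  have h_in: "h x \<in> M" if "x \<in> M" for x
    using that gk gin by (simp add: h_def)
  have h_inv: "h (h x) = x" if x: "x \<in> M" for x
    using x gk[OF x] kg[OF x] gin[OF x] g_ball[OF x] k_ball[OF x] far'[of "g x"]
    by (auto simp: h_def)
  \<comment> \<open>Seen from outside a ball, all its points are as far away as its centre.\<close>
  have out: "d x y = d a y" if "x \<in> M" "y \<in> M" "d a x < s" "s \<le> d a y" for x y
    using isosceles[of x a y] that a by (simp add: commute)
  have out': "d x y = d b y" if "x \<in> M" "y \<in> M" "d b x < s" "s \<le> d b y" for x y
    using isosceles[of x b y] that b by (simp add: commute)
  \<comment> \<open>Each of the two distances is at most the maximum of the other and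
    \<open>s\<close>, and both are at least \<open>s\<close>.\<close>
  have ab: "d a y = d b y" if "y \<in> M" "s \<le> d a y" "s \<le> d b y" for y
    using ultrametric[of a b y] ultrametric[of b a y] that a b s by auto
  have cross: "d x y = s" if "x \<in> M" "y \<in> M" "d a x < s" "d b y < s" for x y
    using out[of x y] far'[of y] that by simp
  have h_d: "d (h x) (h y) = d x y" if x: "x \<in> M" and y: "y \<in> M" for x y
  proof -
    \<comment> \<open>Each point lies in the ball around \<open>a\<close>, in that around
      \<open>b\<close>, or in neither. In a common ball \<open>g\<close> or \<open>k\<close>
      preserves the distance; across the balls it is \<open>s\<close> before and after; with only
      \<open>x\<close> inside, it is \<open>d a y = d b y\<close> before and after.\<close>
    consider "d a x < s" "d a y < s" | "d a x < s" "d b y < s" "\<not> d a y < s"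
      | "d a x < s" "\<not> d a y < s" "\<not> d b y < s"
      | "\<not> d a x < s" "d b x < s" "d a y < s" | "\<not> d a x < s" "d b x < s" "\<not> d a y < s" "d b y < s"
      | "\<not> d a x < s" "d b x < s" "\<not> d a y < s" "\<not> d b y < s"
      | "\<not> d a x < s" "\<not> d b x < s" "d a y < s"
      | "\<not> d a x < s" "\<not> d b x < s" "\<not> d a y < s" "d b y < s"
      | "\<not> d a x < s" "\<not> d b x < s" "\<not> d a y < s" "\<not> d b y < s"
      by blast
    then show ?thesis
    proof cases
      case 1 then show ?thesis using gd x y by (simp add: h_def)
    next
      case 2 then show ?thesis
        using cross[OF x y] cross[of "k y" "g x"] gk gin g_ball k_ball x y
        by (simp add: h_def commute)
    next
      case 3 then show ?thesis
        using out[OF x y] out'[of "g x" y] gin g_ball ab[OF y] x y by (simp add: h_def)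
    next
      case 4 then show ?thesis
        using cross[OF y x] cross[of "k x" "g y"] gk gin g_ball k_ball x y
        by (simp add: h_def commute)
    next
      case 5 then show ?thesis using kd x y by (simp add: h_def)
    next
      case 6 then show ?thesis
        using out'[OF x y] out[of "k x" y] gk k_ball ab[OF y] x y by (simp add: h_def)
    next
      case 7 then show ?thesis
        using out[OF y x] out'[of "g y" x] gin g_ball ab[OF x] x y by (simp add: h_def commute)
    next
      case 8 then show ?thesis
        using out'[OF y x] out[of "k y" x] gk k_ball ab[OF x] x y by (simp add: h_def commute)
    next
      case 9 then show ?thesis by (simp add: h_def)
    qed
  qed
  have "restrict h M \<in> carrier (Isometry_group M d)"
    using h_in h_inv h_d by (rule involution_in_Isometry_group)
  moreover have "restrict h M a = b"
    using a s gab by (simp add: h_def)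
  moreover have "restrict h M x = x" if "x \<in> M" "d a b \<le> d a x" "d a b \<le> d b x" for x
    using that s by (simp add: h_def)
  ultimately show ?thesis
    using that by blast
qed

text \<open>Asking only that \<open>f\<close> map \<open>A\<close> into \<open>M\<close> and
  preserve distances lets the hypotheses pass directly to smaller sets in the induction.\<close>

lemma extend_isometry:
  assumes trans: "\<And>x y. \<lbrakk>x \<in> M; y \<in> M\<rbrakk> \<Longrightarrow> \<exists>g\<in>carrier (Isometry_group M d). g x = y"
    and "finite A" "A \<subseteq> M" "f ` A \<subseteq> M"
    "\<And>x y. \<lbrakk>x \<in> A; y \<in> A\<rbrakk> \<Longrightarrow> d (f x) (f y) = d x y"
  shows "\<exists>g\<in>carrier (Isometry_group M d). \<forall>x\<in>A. g x = f x"
  using assms(2-)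
proof (induction A rule: finite_induct)
  case empty
  have "restrict (\<lambda>x. x) M \<in> carrier (Isometry_group M d)"
    by (rule involution_in_Isometry_group) auto
  then show ?case by blast
next
  case (insert a A)
  then obtain g where g: "g \<in> carrier (Isometry_group M d)" and gf: "\<And>x. x \<in> A \<Longrightarrow> g x = f x"
    by auto
  have gM: "g ` M = M" and gd: "\<And>x y. \<lbrakk>x \<in> M; y \<in> M\<rbrakk> \<Longrightarrow> d (g x) (g y) = d x y"
    using g by (auto simp: carrier_Isometry_group)
  have aM: "a \<in> M" "g a \<in> M" "f a \<in> M"
    using insert.prems gM by auto
  obtain p where "p \<in> carrier (Isometry_group M d)" "p (g a) = f a"
    using trans aM by blast
  then obtain h where h: "h \<in> carrier (Isometry_group M d)" "h (g a) = f a"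
    and fixed: "\<And>x. \<lbrakk>x \<in> M; d (g a) (f a) \<le> d (g a) x; d (g a) (f a) \<le> d (f a) x\<rbrakk> \<Longrightarrow> h x = x"
    using ball_swap aM by metis
  have "h (g x) = f x" if x: "x \<in> A" for x
  proof -
    have xM: "x \<in> M" "f x \<in> M"
      using insert.prems x by auto
    \<comment> \<open>Both \<open>g a\<close> and \<open>f a\<close> have distance
      \<open>d a x\<close> from \<open>f x\<close>, so \<open>d (g a) (f a) \<le> d a x\<close> and
      \<open>h\<close> fixes \<open>f x = g x\<close>.\<close>
    have "d (g a) (f x) = d a x"
      using gd[OF aM(1) xM(1)] gf[OF x] by simp
    moreover have "d (f a) (f x) = d a x"
      using insert.prems(3) x by simp
    ultimately show ?thesis
      using fixed[OF xM(2)] ultrametric[of "g a" "f x" "f a"] aM xM gf[OF x] by (simp add: commute)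
  qed
  moreover have "compose M h g \<in> carrier (Isometry_group M d)"
    using subgroup.m_closed[OF subgroup_Isometry_group h(1) g]
      subgroup.mem_carrier[OF subgroup_Isometry_group g]
      subgroup.mem_carrier[OF subgroup_Isometry_group h(1)]
    by (simp add: BijGroup_def)
  ultimately show ?case
    using h(2) aM(1) insert.prems(1) by (intro bexI[of _ "compose M h g"]) (auto simp: compose_eq)
qed

end

theorem corollary2:
  fixes M :: "'a set" and d :: "'a \<Rightarrow> 'a \<Rightarrow> real"
  assumes "Ultrametric_space M d"
  shows "homogeneous M d \<longleftrightarrow> transitive_action (Isometry_group M d) M (\<lambda>g. g)"
proof -
  interpret Ultrametric_space M d
    by (fact assms)
  interpret group_action "Isometry_group M d" M "\<lambda>g. g"
    by (rule group_action_Isometry_group)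
  have transitive_iff: "transitive_action (Isometry_group M d) M (\<lambda>g. g) \<longleftrightarrow>
      (\<forall>x\<in>M. \<forall>y\<in>M. \<exists>g\<in>carrier (Isometry_group M d). g x = y)"
    using group_action_axioms
    by (auto simp: transitive_action_def transitive_action_axioms_def)
  have "\<exists>g\<in>carrier (Isometry_group M d). g x = y"
    if "homogeneous M d" "x \<in> M" "y \<in> M" for x y
  proof -
    \<comment> \<open>Any map between singletons is an isometry, so homogeneity extends it to one
      taking \<open>x\<close> to \<open>y\<close>.\<close>
    have "isometry d {x} {y} (\<lambda>_. y)"
      using that by (simp add: isometry_def)
    then show ?thesis
      using that unfolding homogeneous_def
      by (metis empty_subsetI finite.emptyI finite.insertI insert_subset singletonI)
  qed
  moreover have "homogeneous M d"
    if trans: "\<And>x y. \<lbrakk>x \<in> M; y \<in> M\<rbrakk> \<Longrightarrow> \<exists>g\<in>carrier (Isometry_group M d). g x = y"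
    unfolding homogeneous_def
  proof (intro allI impI)
    fix A B f assume "A \<subseteq> M" "B \<subseteq> M" "finite A" "isometry d A B f"
    then show "\<exists>g\<in>carrier (Isometry_group M d). \<forall>x\<in>A. g x = f x"
      by (intro extend_isometry[OF trans]) (auto simp: isometry_def bij_betw_def)
  qed
  ultimately show ?thesis
    unfolding transitive_iff by blast
qed

end
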